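(* Let $n$ be an odd positive integer and let $(a_0,a_1,\ldots,a_{n-1})\in\mathbb{F}_2^n$. There exists a normal element of $\mathbb{F}_{2^n}$ over $\mathbb{F}_2$ whose corresponding vector is $(a_0,a_1,\ldots,a_{n-1})$ if and only if the polynomial $f_a(x)=\sum_{0\leq i\leq n-1}a_ix^i\in\mathbb{F}_2[x]$ is symmetric and $\gcd(f_a(x),x^n-1)=1$.
   Context: An element $\alpha\in\mathbb{F}_{2^n}$ is a normal element of $\mathbb{F}_{2^n}$ over $\mathbb{F}_2$ if $\{\alpha,\alpha^2,\alpha^{2^2},\ldots,\alpha^{2^{n-1}}\}$ is a basis of $\mathbb{F}_{2^n}$ over $\mathbb{F}_2$. The trace function is $\mathrm{Tr}_{2^n|2}(x)=\sum_{i=0}^{n-1}x^{2^i}$. The corresponding vector of $\alpha\in\mathbb{F}_{2^n}$ is $(a_0,\ldots,a_{n-1})\in\mathbb{F}_2^n$ with $a_i=\mathrm{Tr}_{2^n|2}(\alpha\cdot\alpha^{2^i})$ for $0\leq i\leq n-1$. A polynomial $a_0+a_1x+\cdots+a_{n-1}x^{n-1}$ is symmetric if $a_i=a_{n-i}$ for all $1\leq i\leq n-1$. *)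

theory Defs
  imports
    "HOL-Library.Z2"
    "HOL-Library.Cardinality"
    "HOL-Computational_Algebra.Computational_Algebra"
    "HOL-Computational_Algebra.Field_as_Ring"
begin

text \<open>
  The field with two elements is the type \<^typ>\<open>bit\<close>. It becomes an instance of
  \<^class>\<open>field_gcd\<close> in the same way as \<^typ>\<open>real\<close> does in
  \<^theory>\<open>HOL-Computational_Algebra.Field_as_Ring\<close>, so that the library's \<^const>\<open>gcd\<close>
  (normalised to be monic) is available on \<^typ>\<open>bit poly\<close>.
\<close>

instantiation bit ::
  "{unique_euclidean_ring, normalization_euclidean_semiring, normalization_semidom_multiplicative}"
begin

definition [simp]: "normalize_bit = (normalize_field :: bit \<Rightarrow> _)"
definition [simp]: "unit_factor_bit = (unit_factor_field :: bit \<Rightarrow> _)"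
definition [simp]: "euclidean_size_bit = (euclidean_size_field :: bit \<Rightarrow> _)"
definition [simp]: "division_segment (x :: bit) = 1"

instance
  by standard (auto simp add: dvd_field_iff split: if_splits)

end

instantiation bit :: euclidean_ring_gcd
begin

definition gcd_bit :: "bit \<Rightarrow> bit \<Rightarrow> bit" where
  "gcd_bit = Euclidean_Algorithm.gcd"
definition lcm_bit :: "bit \<Rightarrow> bit \<Rightarrow> bit" where
  "lcm_bit = Euclidean_Algorithm.lcm"
definition Gcd_bit :: "bit set \<Rightarrow> bit" where
  "Gcd_bit = Euclidean_Algorithm.Gcd"
definition Lcm_bit :: "bit set \<Rightarrow> bit" where
  "Lcm_bit = Euclidean_Algorithm.Lcm"

instance
  by standard (simp_all add: gcd_bit_def lcm_bit_def Gcd_bit_def Lcm_bit_def)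

end

instance bit :: field_gcd ..

text \<open>
  A field of characteristic 2 is a vector space over \<^typ>\<open>bit\<close>, which embeds into it
  via \<^const>\<open>of_bit\<close>; the image is the prime field \<open>{0, 1}\<close>.
\<close>

definition bit_scale :: "bit \<Rightarrow> 'a::field \<Rightarrow> 'a" where
  "bit_scale c x = of_bit c * x"

lemma two_eq_zero_if_card:
  assumes "CARD('a::{field,finite}) = 2 ^ n"
  shows "(2 :: 'a) = 0"
proof -
  have "(\<Sum>x\<in>UNIV. x) = (\<Sum>x\<in>UNIV. x + 1 :: 'a)"
    by (rule sum.reindex_bij_witness[of _ "\<lambda>x. x + 1" "\<lambda>x. x - 1"]) auto
  then have "of_nat CARD('a) = (0 :: 'a)"
    by (simp add: sum.distrib)
  then show ?thesis
    by (simp add: assms)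
qed

lemma vector_space_bit_scale:
  assumes "(2 :: 'a::field) = 0"
  shows "vector_space (bit_scale :: bit \<Rightarrow> 'a \<Rightarrow> 'a)"
proof -
  have *: "x + x = 0" for x :: 'a
    using assms by (metis mult_2 mult_zero_left)
  have "of_bit (c + d) = (of_bit c + of_bit d :: 'a)" for c d
    by (cases c; cases d) (simp_all add: *)
  moreover have "of_bit (c * d) = (of_bit c * of_bit d :: 'a)" for c d
    by (cases c; cases d) simp_all
  ultimately show ?thesis
    by unfold_locales
      (simp_all only: bit_scale_def distrib_left distrib_right mult.assoc odd_one not_False_eq_True of_bool_eq mult_1_left)
qed

definition normal_element :: "nat \<Rightarrow> 'a::field \<Rightarrow> bool" where
  "normal_element n \<alpha> \<longleftrightarrow>
     (let B = {\<alpha> ^ (2 ^ i) | i. i < n} in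
        \<not> module.dependent bit_scale B \<and> module.span bit_scale B = UNIV)"

definition trace_map :: "nat \<Rightarrow> 'a::field \<Rightarrow> 'a" where
  "trace_map n x = (\<Sum>i<n. x ^ (2 ^ i))"

definition corresponding_vector :: "nat \<Rightarrow> 'a::field \<Rightarrow> nat \<Rightarrow> 'a" where
  "corresponding_vector n \<alpha> i = trace_map n (\<alpha> * \<alpha> ^ (2 ^ i))"

definition vector_poly :: "nat \<Rightarrow> (nat \<Rightarrow> 'b::comm_monoid_add) \<Rightarrow> 'b poly" where
  "vector_poly n a = (\<Sum>i<n. monom (a i) i)"

definition symmetric_poly :: "nat \<Rightarrow> 'b::zero poly \<Rightarrow> bool" where
  "symmetric_poly n p \<longleftrightarrow> (\<forall>i\<in>{1..n-1}. coeff p i = coeff p (n - i))"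

end

(* Let the indeterminate X act on the field K with 2^n elements as the Frobenius map, so that K is
   a module over A = F_2[X]/(X^n - 1), and normal elements are the free generators of K. Put
   F(x, y) = sum_i Tr(x y^(2^i)) X^i. This form is sesquilinear over A for the involution
   p*(X) = p(X^(-1)), and f_a = F(alpha, alpha) for the vector a of alpha; hence f_a is symmetric.
   As the trace form is nondegenerate, alpha is a free generator exactly if F(alpha, alpha) is a
   unit of A. Conversely, let f be a symmetric unit and beta a normal element, and write
   f = u F(beta, beta), where u = u*. For odd n, squaring permutes the monomials of A, so u = h^2
   with h = h*, and F(h beta, h beta) = h h* F(beta, beta) = f. *)

theory Submission
  imports Defs "HOL-Number_Theory.Cong"
begin

text \<open>As default simp rules these replace the ring operations on \<open>bit\<close>; without
  them, terms keep the ring form that the polynomial rules expect.\<close>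

declare add_bit_eq_xor [simp del] mult_bit_eq_and [simp del] minus_bit_def [simp del]
  uminus_bit_def [simp del]

section \<open>Arithmetic in F_2[X]: coefficient vectors, squaring, substitution\<close>

lemma bit_add_self [simp]: "x + x = (0::bit)"
  by (cases x) (simp_all add: one_add_one)

lemma bit_poly_two [simp]: "(2 :: bit poly) = 0"
  by (simp add: numeral_poly)

lemma bit_poly_add_self [simp]: "p + p = (0 :: bit poly)"
  by (simp flip: mult_2)

lemma of_nat_odd_bit: "odd k \<Longrightarrow> (of_nat k :: bit) = 1"
  by (elim oddE) simp

lemma coeff_vector_poly: "coeff (vector_poly n a) i = (if i < n then a i else 0)"
  by (simp add: vector_poly_def coeff_sum coeff_monom sum.delta' if_distrib cong: if_cong)

lemma degree_vector_poly_less: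
  assumes "n > 0"
  shows "degree (vector_poly n a) < n"
proof (cases "vector_poly n a = 0")
  case False
  then show ?thesis
    using leading_coeff_neq_0[OF False] by (auto simp: coeff_vector_poly split: if_splits)
qed (use assms in simp)

lemma vector_poly_coeff:
  assumes "degree p < n"
  shows "vector_poly n (coeff p) = p"
  using assms by (auto simp: poly_eq_iff coeff_vector_poly coeff_eq_0)

text \<open>Over F_2 a polynomial is determined by its support. The count equals the size of the
  field, so that injectivity and surjectivity of p -> p(\<alpha>) will coincide.\<close>

lemma card_bit_poly_degree_less:
  assumes "n > 0"
  shows "finite {p :: bit poly. degree p < n}" "card {p :: bit poly. degree p < n} = 2 ^ n"
proof -
  have "bij_betw (\<lambda>p :: bit poly. {i. coeff p i = 1}) {p. degree p < n} (Pow {..<n})"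
  proof (rule bij_betwI[where g = "\<lambda>S. vector_poly n (\<lambda>i. of_bool (i \<in> S))"])
    show "(\<lambda>p :: bit poly. {i. coeff p i = 1}) \<in> {p. degree p < n} \<rightarrow> Pow {..<n}"
      by (auto simp: not_le[symmetric] intro: ccontr dest: coeff_eq_0[OF le_less_trans[rotated]])
         (metis coeff_eq_0 linorder_not_less order_less_le_trans zero_neq_one)
    show "(\<lambda>S. vector_poly n (\<lambda>i. of_bool (i \<in> S)) :: bit poly)
        \<in> Pow {..<n} \<rightarrow> {p. degree p < n}"
      using degree_vector_poly_less[OF assms] by auto
    fix p :: "bit poly"
    assume "p \<in> {p. degree p < n}"
    moreover have "of_bool (i \<in> {i. coeff p i = 1}) = coeff p i" for i
      by (cases "coeff p i") simp_all
    ultimately show "vector_poly n (\<lambda>i. of_bool (i \<in> {i. coeff p i = 1})) = p"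
      using vector_poly_coeff[of p n] by simp
  next
    fix S assume "S \<in> Pow {..<n}"
    then show "{i. coeff (vector_poly n (\<lambda>i. of_bool (i \<in> S) :: bit)) i = 1} = S"
      by (auto simp: coeff_vector_poly)
  qed
  then show "finite {p :: bit poly. degree p < n}" "card {p :: bit poly. degree p < n} = 2 ^ n"
    by (simp_all add: bij_betw_finite bij_betw_same_card card_Pow)
qed

text \<open>The cross terms cancel in characteristic 2, and c^2 = c for c in F_2. Square roots
  modulo X^n - 1 are found through this substitution.\<close>

lemma bit_poly_square: "p ^ 2 = pcompose p (monom 1 2)" for p :: "bit poly"
proof (induction p)
  case (pCons c p)
  have "(pCons c p) ^ 2 = ([:c:] + monom 1 1 * p) ^ 2"
    by (simp add: monom_altdef)
  also have "\<dots> = [:c:] ^ 2 + (monom 1 1) ^ 2 * p ^ 2 + ([:c:] * monom 1 1 * p + [:c:] * monom 1 1 * p)"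
    by (simp add: power2_eq_square algebra_simps del: bit_poly_add_self)
  also have "\<dots> = [:c:] + monom 1 2 * p ^ 2"
    by (cases c) (simp_all add: power2_eq_square mult_monom one_pCons numeral_2_eq_2)
  finally show ?case
    by (simp add: pCons.IH pcompose_pCons)
qed simp

text \<open>Geometric sum in X^n.\<close>

lemma monom_diff_one_dvd: "monom 1 n - 1 dvd (monom 1 (n * k) - 1 :: 'a::comm_ring_1 poly)"
proof -
  have "(monom 1 n :: 'a poly) ^ k - 1 = (monom 1 n - 1) * (\<Sum>i<k. monom 1 n ^ i)"
    by (rule power_diff_1_eq)
  then show ?thesis
    by (simp add: monom_power)
qed

lemma pcompose_monom: "pcompose (monom c k) q = smult c (q ^ k)"
  for q :: "'a::comm_semiring_1 poly"
  by (induction k) (simp_all add: monom_0 monom_Suc pcompose_pCons)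

lemma monom_pcompose_monom: "pcompose (monom c k) (monom 1 m) = monom c (m * k)"
  for c :: "'a::comm_semiring_1"
  by (simp add: pcompose_monom monom_power smult_monom)

section \<open>The Frobenius action of F_2[X]\<close>

text \<open>The value at \<open>x\<close> of the linearized polynomial attached to \<open>p\<close>.
  All of F_2[X] acts; the quotient by X^n - 1 is handled by congruences.\<close>

definition frob_act :: "bit poly \<Rightarrow> 'a::field \<Rightarrow> 'a" where
  "frob_act p x = (\<Sum>i\<le>degree p. of_bit (coeff p i) * x ^ (2 ^ i))"

lemma frob_act_eq_sum:
  assumes "degree p < m"
  shows "frob_act p x = (\<Sum>i<m. of_bit (coeff p i) * x ^ (2 ^ i))"
  unfolding frob_act_def
  by (rule sum.mono_neutral_left) (use assms in \<open>auto simp: coeff_eq_0\<close>)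

text \<open>Horner recursion, in which X moves the remaining coefficients to x^2. It drives the
  inductions over polynomials that follow, hence \<open>x\<close> is kept arbitrary there.\<close>

lemma frob_act_pCons: "frob_act (pCons c p) x = of_bit c * x + frob_act p (x ^ 2)"
proof -
  have "frob_act (pCons c p) x = (\<Sum>i<Suc (Suc (degree p)). of_bit (coeff (pCons c p) i) * x ^ (2 ^ i))"
    by (rule frob_act_eq_sum) (use degree_pCons_le[of c p] in simp)
  also have "\<dots> = of_bit c * x + (\<Sum>i<Suc (degree p). of_bit (coeff p i) * (x ^ 2) ^ (2 ^ i))"
    by (subst sum.lessThan_Suc_shift) (simp flip: power_mult)
  also have "\<dots> = of_bit c * x + frob_act p (x ^ 2)"
    by (simp add: frob_act_eq_sum[of p "Suc (degree p)"])
  finally show ?thesis .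
qed

lemma frob_act_0 [simp]: "frob_act 0 x = 0"
  by (simp add: frob_act_def)

lemma frob_act_1 [simp]: "frob_act 1 x = x"
  by (simp add: frob_act_def)

lemma frob_act_zero_right [simp]: "frob_act p 0 = 0"
  by (simp add: frob_act_def power_0_left)

lemma frob_act_monom: "frob_act (monom 1 k) x = x ^ (2 ^ k)"
  by (induction k arbitrary: x) (simp_all add: monom_Suc frob_act_pCons power_mult)

section \<open>The field with 2^n elements as an F_2[X]-module\<close>

locale binary_field =
  fixes n :: nat and K :: "'a::{field,finite} itself"
  assumes odd_n: "odd n"
    and card_K: "CARD('a) = 2 ^ n"
begin

lemma n_pos: "n > 0"
  using odd_n by (cases n) auto

lemma two_eq_zero [simp]: "(2::'a) = 0"
  by (rule two_eq_zero_if_card) (fact card_K)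

lemma add_self [simp]: "x + x = (0::'a)"
  by (simp flip: mult_2)

lemma of_bit_add: "(of_bit (c + d) :: 'a) = of_bit c + of_bit d"
  by (cases c; cases d) simp_all

lemma square_add: "(x + y) ^ 2 = x ^ 2 + (y::'a) ^ 2"
  by (simp add: power2_sum)

lemma frobenius_add: "(x + y) ^ (2 ^ i) = x ^ (2 ^ i) + (y::'a) ^ (2 ^ i)"
  by (induction i) (simp_all add: power_mult square_add mult.commute[of 2])

lemma frobenius_sum: "(\<Sum>j\<in>A. f j) ^ (2 ^ i) = (\<Sum>j\<in>A. (f j :: 'a) ^ (2 ^ i))"
  by (induction A rule: infinite_finite_induct) (simp_all add: frobenius_add)

text \<open>Multiplication by a nonzero \<open>x\<close> permutes the nonzero elements; comparing
  their products gives x^(2^n - 1) = 1.\<close>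

lemma frobenius_n [simp]: "(x::'a) ^ (2 ^ n) = x"
proof (cases "x = 0")
  case False
  let ?U = "UNIV - {0::'a}"
  have "prod (\<lambda>y. x * y) ?U = prod (\<lambda>y. y) ?U"
    by (rule prod.reindex_bij_witness[of _ "\<lambda>y. y / x" "\<lambda>y. x * y"]) (use False in auto)
  then have "x ^ card ?U = 1"
    by (simp add: prod.distrib)
  then have "x * x ^ card ?U = x"
    by simp
  moreover have "Suc (card ?U) = 2 ^ n"
    using card_K by (simp add: card_Suc_Diff1)
  ultimately show ?thesis
    by (metis power_Suc)
qed simp

lemma frob_act_add_right: "frob_act p (x + y) = frob_act p x + frob_act p (y::'a)"
  by (simp add: frob_act_def frobenius_add distrib_left sum.distrib)

lemma frob_act_add_left: "frob_act (p + q) x = frob_act p x + frob_act q (x::'a)"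
proof -
  define m where "m = Suc (max (degree p) (degree q))"
  have deg: "degree p < m" "degree q < m" "degree (p + q) < m"
    using degree_add_le_max[of p q] by (auto simp: m_def)
  show ?thesis
    by (simp only: deg[THEN frob_act_eq_sum] coeff_add of_bit_add distrib_right sum.distrib)
qed

lemma frob_act_square: "frob_act p (x ^ 2) = (frob_act p (x::'a)) ^ 2"
proof (induction p arbitrary: x)
  case (pCons c p)
  show ?case
    using pCons.IH[of "x ^ 2"] by (cases c) (simp_all add: frob_act_pCons square_add)
qed simp

lemma frob_act_smult: "frob_act (smult c p) x = of_bit c * frob_act p (x::'a)"
  by (cases c) simp_all

text \<open>Composition matches multiplication because the coefficients lie in F_2 and so the action
  commutes with squaring.\<close>

lemma frob_act_mult: "frob_act (p * q) x = frob_act p (frob_act q (x::'a))"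
proof (induction p arbitrary: x)
  case (pCons c p)
  then show ?case
    by (simp add: frob_act_add_left frob_act_smult frob_act_pCons frob_act_square)
qed simp

section \<open>The modulus X^n - 1 and its factors\<close>

abbreviation modulus :: "bit poly" where
  "modulus \<equiv> monom 1 n - 1"

lemma modulus_eq: "modulus = monom 1 n + 1"
  by (rule poly_eqI) (simp only: coeff_diff coeff_add minus_bit_def)

lemma frob_act_modulus [simp]: "frob_act modulus x = (0::'a)"
  by (simp add: modulus_eq frob_act_add_left frob_act_monom)

lemma degree_modulus [simp]: "degree modulus = n"
proof -
  have "degree (monom 1 n + (1 :: bit poly)) = degree (monom (1::bit) n)"
    by (rule degree_add_eq_left) (simp add: degree_monom_eq n_pos)
  then show ?thesis
    by (simp add: modulus_eq degree_monom_eq)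
qed

lemma modulus_nonzero: "modulus \<noteq> 0"
  using degree_modulus n_pos by (metis degree_0 less_irrefl)

text \<open>Uniqueness of reduced representatives; it turns congruences between trace polynomials
  back into equations.\<close>

lemma eq_if_cong:
  assumes "[p = q] (mod modulus)" "degree p < n" "degree q < n"
  shows "p = q"
  using assms by (simp add: cong_def mod_poly_less)

lemma eq_zero_if_modulus_dvd:
  assumes "modulus dvd p" "degree p < n"
  shows "p = 0"
  using assms dvd_imp_degree_le[OF assms(1)] by (cases "p = 0") simp_all

text \<open>X^n - 1 is squarefree: for odd \<open>n\<close> its derivative is X^(n-1), so a common
  factor of \<open>p\<close> and \<open>q\<close> divides X^n as well as X^n - 1, hence 1.\<close>

lemma coprime_modulus_factors:
  assumes "modulus = p * q"
  shows "coprime p q"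
proof (rule coprimeI)
  fix d assume d: "d dvd p" "d dvd q"
  have "pderiv modulus = monom 1 (n - 1)"
    using odd_n by (simp add: pderiv_diff pderiv_monom of_nat_odd_bit)
  then have "monom 1 (n - 1) = p * pderiv q + q * pderiv p"
    by (simp add: assms pderiv_mult)
  then have "d dvd monom 1 (n - 1)"
    using d by simp
  then have "d dvd monom 1 1 * monom 1 (n - 1)"
    by simp
  also have "monom 1 1 * monom 1 (n - 1) = (monom 1 n :: bit poly)"
    using n_pos by (simp add: mult_monom)
  finally have "d dvd monom 1 n" .
  moreover have "d dvd modulus"
    using d(1) unfolding assms by simp
  ultimately have "d dvd monom 1 n - modulus"
    by (rule dvd_diff)
  then show "is_unit d"
    by simp
qed

section \<open>Annihilators and the existence of a free generator\<close>

text \<open>The linearized polynomial \<open>L\<close> is nonzero of degree at most 2^(n-1), too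
  small to vanish on all 2^n field elements.\<close>

lemma exists_frob_act_nonzero:
  assumes "p \<noteq> 0" "degree p < n"
  shows "\<exists>x::'a. frob_act p x \<noteq> 0"
proof (rule ccontr)
  assume "\<not> ?thesis"
  then have zero: "frob_act p x = 0" for x :: 'a
    by simp
  define L :: "'a poly" where "L = (\<Sum>i<n. monom (of_bit (coeff p i)) (2 ^ i))"
  have "poly L x = 0" for x
    using zero[of x] assms(2)
    by (simp add: L_def poly_sum poly_monom frob_act_eq_sum[of p n])
  moreover have "L \<noteq> 0"
  proof
    assume "L = 0"
    have "coeff p (degree p) = 1"
      using leading_coeff_neq_0[OF assms(1)] by (simp only: bit_not_zero_iff)
    \<comment> \<open>The exponents 2^i are distinct, so the leading term of \<open>p\<close> meets
      no other term in \<open>L\<close>.\<close>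
    then have "coeff L (2 ^ degree p) = 1"
      using assms(2) by (simp add: L_def coeff_sum coeff_monom)
    with \<open>L = 0\<close> show False
      by simp
  qed
  ultimately have "CARD('a) \<le> degree L"
    using card_poly_roots_bound[of L] by simp
  also have "degree L \<le> 2 ^ (n - 1)"
    unfolding L_def
    by (intro degree_sum_le order.trans[OF degree_monom_le]) (auto intro: power_increasing)
  also have "(2::nat) ^ (n - 1) < 2 ^ n"
    using n_pos by simp
  finally show False
    by (simp add: card_K)
qed

text \<open>The annihilator is a nonzero ideal, since it contains X^n - 1; division with remainder
  shows that an element of least degree generates it.\<close>

lemma annihilator_generator:
  obtains m where "frob_act m (x::'a) = 0" "m dvd modulus"
    "\<And>p. frob_act p x = 0 \<Longrightarrow> m dvd p"
proof -
  define m where "m = arg_min degree (\<lambda>p. p \<noteq> 0 \<and> frob_act p x = 0)"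
  have m: "m \<noteq> 0" "frob_act m x = 0"
    using arg_min_natI[of "\<lambda>p. p \<noteq> 0 \<and> frob_act p x = 0" modulus degree] modulus_nonzero
      frob_act_modulus[of x]
    unfolding m_def by blast+
  have min: "degree m \<le> degree p" if "p \<noteq> 0" "frob_act p x = 0" for p
    using that arg_min_nat_le[of "\<lambda>p. p \<noteq> 0 \<and> frob_act p x = 0" p degree]
    by (simp add: m_def)
  have dvd: "m dvd p" if "frob_act p x = 0" for p
  proof -
    have "frob_act (p div m * m + p mod m) x = 0"
      using that by (simp only: div_mult_mod_eq)
    then have "frob_act (p mod m) x = 0"
      unfolding frob_act_add_left frob_act_mult using m by simp
    then show ?thesis
      using min[of "p mod m"] degree_mod_less[OF m(1), of p] by fastforce
  qed
  show ?thesis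
    using that[of m] m dvd by simp
qed

lemma frob_act_eq_zero_if_coprime:
  assumes "coprime p q" "frob_act p x = 0" "frob_act q x = 0"
  shows "x = (0::'a)"
proof -
  obtain s t where "s * p + t * q = 1"
    using assms(1) bezout_coefficients[of p q] by (metis coprime_iff_gcd_eq_1 prod.collapse)
  then have "x = frob_act (s * p + t * q) x"
    by simp
  also have "\<dots> = 0"
    using assms by (simp add: frob_act_add_left frob_act_mult)
  finally show ?thesis .
qed

text \<open>If \<open>m\<close> generates the annihilator of \<open>x\<close>, then \<open>x + m y\<close> works: \<open>m\<close> is coprime to
  the cofactor \<open>m'\<close> of \<open>X^n - 1\<close>, and \<open>m'\<close> kills \<open>m y\<close>.\<close>

lemma common_annihilator:
  "\<exists>z::'a. \<forall>p. frob_act p z = 0 \<longrightarrow> frob_act p (x::'a) = 0 \<and> frob_act p (y::'a) = 0"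
proof -
  obtain m where m: "frob_act m x = 0" "m dvd modulus" "\<And>p. frob_act p x = 0 \<Longrightarrow> m dvd p"
    using annihilator_generator[of x] by blast
  obtain m' where m': "modulus = m * m'"
    using m(2) by (elim dvdE)
  have cop: "coprime m m'"
    using m' by (rule coprime_modulus_factors)
  have comm: "frob_act p (frob_act q v) = frob_act q (frob_act p v)" for p q and v :: 'a
    unfolding frob_act_mult[symmetric] by (simp only: mult.commute)
  have kill: "frob_act m' (frob_act m v) = 0" for v :: 'a
    using frob_act_modulus[of v] unfolding m' frob_act_mult comm[of m] .
  show ?thesis
  proof (intro exI[of _ "x + frob_act m y"] allI impI)
    fix p assume "frob_act p (x + frob_act m y) = 0"
    then have *: "frob_act p x + frob_act p (frob_act m y) = 0"
      by (simp add: frob_act_add_right)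
    have "frob_act m' (frob_act p x + frob_act p (frob_act m y)) = 0"
      using * by simp
    then have "frob_act m' (frob_act p x) = 0"
      by (simp only: frob_act_add_right comm[of m' p] kill frob_act_zero_right add_0_right)
    moreover have "frob_act m (frob_act p x) = 0"
      by (simp only: comm[of m p] m(1) frob_act_zero_right)
    ultimately have x: "frob_act p x = 0"
      using frob_act_eq_zero_if_coprime[OF cop] by blast
    then have "m dvd p"
      by (rule m(3))
    then obtain q where q: "p = m * q"
      by (elim dvdE)
    \<comment> \<open>Now \<open>m\<close> kills p y by what is left of the assumption, and
      \<open>m'\<close> kills it because \<open>p\<close> is a multiple of \<open>m\<close>.\<close>
    have "frob_act m (frob_act p y) = 0"
      using * x by (simp only: comm[of m p] add_0)
    moreover have "frob_act m' (frob_act p y) = 0"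
      by (simp add: q frob_act_mult kill)
    ultimately have "frob_act p y = 0"
      using frob_act_eq_zero_if_coprime[OF cop] by blast
    with x show "frob_act p x = 0 \<and> frob_act p y = 0"
      by simp
  qed
qed

text \<open>Since X^n - 1 kills everything, only reduced \<open>p\<close> need testing: the
  annihilator of \<open>x\<close> is to be no larger than the ideal of X^n - 1.\<close>

definition free_element :: "'a \<Rightarrow> bool" where
  "free_element x \<longleftrightarrow> (\<forall>p. degree p < n \<longrightarrow> frob_act p x = 0 \<longrightarrow> p = 0)"

text \<open>Normal basis theorem: folding \<open>common_annihilator\<close> over the finite field
  gives \<open>z\<close> whose annihilator kills every element, and no nonzero \<open>p\<close> of
  degree below \<open>n\<close> does that.\<close>

lemma exists_free_element: "\<exists>x. free_element x"
proof -
  have "\<exists>z::'a. \<forall>p. frob_act p z = 0 \<longrightarrow> (\<forall>x\<in>S. frob_act p x = 0)" if "finite S" for S :: "'a set"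
    using that
  proof (induction S rule: finite_induct)
    case (insert y S)
    then obtain x :: 'a where x: "\<forall>p. frob_act p x = 0 \<longrightarrow> (\<forall>x\<in>S. frob_act p x = 0)"
      by (elim exE)
    obtain z :: 'a where z: "\<forall>p. frob_act p z = 0 \<longrightarrow> frob_act p x = 0 \<and> frob_act p y = 0"
      using common_annihilator[of x y] by (elim exE)
    show ?case
    proof (intro exI[of _ z] allI impI ballI)
      fix p v assume "frob_act p z = 0" "v \<in> insert y S"
      then show "frob_act p v = 0"
        using x z by blast
    qed
  qed simp
  from this[OF finite[of UNIV]] obtain z :: 'a
    where z: "\<And>p x. frob_act p z = 0 \<Longrightarrow> frob_act p x = (0::'a)"
    by blast
  have "free_element z"
    unfolding free_element_def
  proof (intro allI impI)
    fix p assume p: "degree p < n" "frob_act p z = 0"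
    show "p = 0"
      using exists_frob_act_nonzero[OF _ p(1)] z[OF p(2)] by metis
  qed
  then show ?thesis ..
qed

section \<open>Normal elements as free generators\<close>

interpretation bit_space: vector_space "bit_scale :: bit \<Rightarrow> 'a \<Rightarrow> 'a"
  by (rule vector_space_bit_scale) (rule two_eq_zero)

text \<open>Freeness is triviality of the kernel of an additive map between finite sets of equal
  size.\<close>

lemma free_element_iff_surj:
  "free_element x \<longleftrightarrow> (\<lambda>p. frob_act p x) ` {p. degree p < n} = UNIV"
proof -
  let ?P = "{p :: bit poly. degree p < n}"
  have "free_element x \<longleftrightarrow> inj_on (\<lambda>p. frob_act p x) ?P"
  proof
    assume free: "free_element x"
    show "inj_on (\<lambda>p. frob_act p x) ?P"
    proof (rule inj_onI)
      fix p q assume pq: "p \<in> ?P" "q \<in> ?P" "frob_act p x = frob_act q x"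
      then have "frob_act (p + q) x = 0"
        by (simp add: frob_act_add_left)
      moreover have "degree (p + q) < n"
        using pq by (intro degree_add_less) auto
      ultimately have "p + q = 0"
        using free by (simp add: free_element_def)
      then have "p + (q + q) = q"
        by (simp only: add.assoc[symmetric]) simp
      then show "p = q"
        by simp
    qed
  next
    assume inj: "inj_on (\<lambda>p. frob_act p x) ?P"
    show "free_element x"
      unfolding free_element_def using inj_onD[OF inj, of _ 0] n_pos by simp
  qed
  also have "\<dots> \<longleftrightarrow> card ((\<lambda>p. frob_act p x) ` ?P) = CARD('a)"
    using card_bit_poly_degree_less[OF n_pos]
    by (auto simp: card_K inj_on_iff_eq_card)
  also have "\<dots> \<longleftrightarrow> (\<lambda>p. frob_act p x) ` ?P = UNIV"
    using card_subset_eq[of UNIV "(\<lambda>p. frob_act p x) ` ?P"] by auto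
  finally show ?thesis .
qed

text \<open>The span of the conjugates is the image of p -> p(\<alpha>), so spanning already amounts
  to freeness; independence then follows from freeness.\<close>

lemma normal_element_iff_free: "normal_element n \<alpha> \<longleftrightarrow> free_element \<alpha>"
proof -
  define B where "B = (\<lambda>i. \<alpha> ^ (2 ^ i)) ` {..<n}"
  have B: "{\<alpha> ^ (2 ^ i) | i. i < n} = B"
    by (auto simp: B_def)
  have span: "bit_space.span B = (\<lambda>p. frob_act p \<alpha>) ` {p. degree p < n}"
  proof (intro equalityI subsetI)
    fix y assume "y \<in> bit_space.span B"
    then show "y \<in> (\<lambda>p. frob_act p \<alpha>) ` {p. degree p < n}"
    proof (induction rule: bit_space.span_induct_alt)
      case base
      show ?case
        using n_pos by (intro image_eqI[of _ _ 0]) auto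
    next
      case (step c x y)
      then obtain i p where "x = \<alpha> ^ (2 ^ i)" "i < n" "y = frob_act p \<alpha>" "degree p < n"
        by (auto simp: B_def)
      then have "bit_scale c x + y = frob_act (smult c (monom 1 i) + p) \<alpha>"
        and "degree (smult c (monom 1 i) + p) < n"
        by (simp_all add: bit_scale_def frob_act_add_left frob_act_smult frob_act_monom
            degree_add_less degree_monom_eq le_less_trans[OF degree_smult_le])
      then show ?case
        by (intro image_eqI[of _ _ "smult c (monom 1 i) + p"]) simp_all
    qed
  next
    fix y assume "y \<in> (\<lambda>p. frob_act p \<alpha>) ` {p. degree p < n}"
    then obtain p where "degree p < n" "y = frob_act p \<alpha>"
      by auto
    then have "y = (\<Sum>i<n. bit_scale (coeff p i) (\<alpha> ^ (2 ^ i)))"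
      by (simp add: frob_act_eq_sum[of p n] bit_scale_def)
    also have "\<dots> \<in> bit_space.span B"
      by (intro bit_space.span_sum bit_space.span_scale bit_space.span_base) (auto simp: B_def)
    finally show "y \<in> bit_space.span B" .
  qed
  have "\<not> bit_space.dependent B" if free: "free_element \<alpha>"
  proof
    assume "bit_space.dependent B"
    then obtain u v where u: "(\<Sum>v\<in>B. bit_scale (u v) v) = 0" and v: "v \<in> B" "u v \<noteq> 0"
      by (subst (asm) bit_space.dependent_finite) (auto simp: B_def)
    \<comment> \<open>\<open>B\<close> is a set, in which equal conjugates would collapse;
      distinctness lets a dependency over \<open>B\<close> be indexed by exponents.\<close>
    have "inj_on (\<lambda>i. \<alpha> ^ (2 ^ i)) {..<n}"
    proof (rule inj_onI)
      fix i j assume ij: "i \<in> {..<n}" "j \<in> {..<n}" "\<alpha> ^ (2 ^ i) = \<alpha> ^ (2 ^ j)"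
      then have "frob_act (monom 1 i + monom 1 j) \<alpha> = 0"
        by (simp add: frob_act_add_left frob_act_monom)
      moreover have "degree (monom 1 i + monom (1::bit) j) < n"
        using ij by (simp add: degree_add_less degree_monom_eq)
      ultimately have "monom 1 i + monom (1::bit) j = 0"
        using free by (simp add: free_element_def)
      then have "coeff (monom 1 i + monom (1::bit) j) i = 0"
        by simp
      then show "i = j"
        by (auto simp: coeff_monom split: if_splits)
    qed
    define p where "p = vector_poly n (\<lambda>i. u (\<alpha> ^ (2 ^ i)))"
    have "frob_act p \<alpha> = (\<Sum>i<n. bit_scale (u (\<alpha> ^ (2 ^ i))) (\<alpha> ^ (2 ^ i)))"
      by (simp add: p_def frob_act_eq_sum[OF degree_vector_poly_less[OF n_pos]]
          coeff_vector_poly bit_scale_def)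
    also have "\<dots> = (\<Sum>v\<in>B. bit_scale (u v) v)"
      unfolding B_def by (subst sum.reindex) (use \<open>inj_on _ _\<close> in simp_all)
    finally have "frob_act p \<alpha> = 0"
      using u by simp
    then have "p = 0"
      using free degree_vector_poly_less[OF n_pos] unfolding free_element_def p_def by blast
    then have "u (\<alpha> ^ (2 ^ i)) = 0" if "i < n" for i
      using that coeff_vector_poly[of n "\<lambda>i. u (\<alpha> ^ (2 ^ i))" i] by (simp add: p_def)
    with v show False
      by (auto simp: B_def)
  qed
  then show ?thesis
    unfolding normal_element_def Let_def B span free_element_iff_surj[symmetric] by blast
qed

section \<open>The trace and its values in F_2\<close>

lemma trace_add: "trace_map n (x + y) = trace_map n x + trace_map n (y::'a)"
  by (simp add: trace_map_def frobenius_add sum.distrib)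

lemma trace_square: "trace_map n (x ^ 2) = trace_map n (x::'a)"
proof -
  have "trace_map n (x ^ 2) = (\<Sum>i<n. x ^ (2 ^ Suc i))"
    by (simp add: trace_map_def power_mult)
  \<comment> \<open>Here \<open>x\<close> is the term at index 0; next it is split off again as the
    term at index \<open>n\<close>, since x^(2^n) = x.\<close>
  also have "\<dots> + x = (\<Sum>i<Suc n. x ^ (2 ^ i))"
    by (subst sum.lessThan_Suc_shift) (simp add: add.commute)
  also have "\<dots> = trace_map n x + x"
    by (simp add: trace_map_def)
  finally show ?thesis
    by simp
qed

lemma trace_frobenius: "trace_map n (x ^ (2 ^ i)) = trace_map n (x::'a)"
  by (induction i) (simp_all add: power_mult trace_square mult.commute[of 2])

lemma trace_cases: "trace_map n (x::'a) = 0 \<or> trace_map n x = 1"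
proof -
  have "trace_map n x ^ 2 = trace_map n (x ^ 2)"
    using frobenius_sum[of "\<lambda>i. x ^ (2 ^ i)" "{..<n}" 1]
    by (simp add: trace_map_def mult.commute flip: power_mult)
  then have "trace_map n x ^ 2 = trace_map n x"
    by (simp only: trace_square)
  then have "trace_map n x * (trace_map n x - 1) = 0"
    by (simp add: power2_eq_square algebra_simps)
  then show ?thesis
    by simp
qed

text \<open>The trace is the action of 1 + X + ... + X^(n-1), a nonzero polynomial of degree below
  \<open>n\<close>.\<close>

lemma exists_trace_nonzero: "\<exists>x::'a. trace_map n x \<noteq> 0"
proof -
  define S :: "bit poly" where "S = vector_poly n (\<lambda>_. 1)"
  have "degree S < n"
    by (simp add: S_def degree_vector_poly_less n_pos)
  moreover have "coeff S 0 = 1"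
    using n_pos by (simp add: S_def coeff_vector_poly)
  then have "S \<noteq> 0"
    by auto
  moreover have "frob_act S x = trace_map n x" for x :: 'a
    unfolding frob_act_eq_sum[OF \<open>degree S < n\<close>] trace_map_def
    by (rule sum.cong) (simp_all add: S_def coeff_vector_poly)
  ultimately show ?thesis
    using exists_frob_act_nonzero[of S] by auto
qed

text \<open>The trace pulled back along \<open>of_bit\<close>; by \<open>trace_cases\<close> no
  information is lost.\<close>

definition trace_bit :: "'a \<Rightarrow> bit" where
  "trace_bit x = of_bool (trace_map n x \<noteq> 0)"

lemma of_bit_trace_bit: "of_bit (trace_bit x) = trace_map n x"
  using trace_cases[of x] by (auto simp: trace_bit_def)

lemma trace_bit_eqI: "trace_map n x = trace_map n y \<Longrightarrow> trace_bit x = trace_bit y"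
  by (simp add: trace_bit_def)

lemma trace_bit_zero [simp]: "trace_bit 0 = 0"
  by (simp add: trace_bit_def trace_map_def power_0_left)

lemma trace_bit_add: "trace_bit (x + y) = trace_bit x + trace_bit y"
  using trace_cases[of x] trace_cases[of y] by (auto simp: trace_bit_def trace_add)

section \<open>The form F(x, y) and its sesquilinearity\<close>

definition trace_poly :: "'a \<Rightarrow> 'a \<Rightarrow> bit poly" where
  "trace_poly x y = vector_poly n (\<lambda>i. trace_bit (x * y ^ (2 ^ i)))"

lemma coeff_trace_poly:
  "coeff (trace_poly x y) i = (if i < n then trace_bit (x * y ^ (2 ^ i)) else 0)"
  by (simp add: trace_poly_def coeff_vector_poly)

lemma degree_trace_poly: "degree (trace_poly x y) < n"
  by (simp add: trace_poly_def degree_vector_poly_less n_pos)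

lemma trace_poly_add_left: "trace_poly (x + y) z = trace_poly x z + trace_poly y z"
  by (simp add: poly_eq_iff coeff_trace_poly distrib_right trace_bit_add)

lemma trace_poly_add_right: "trace_poly x (y + z) = trace_poly x y + trace_poly x z"
  by (simp add: poly_eq_iff coeff_trace_poly distrib_left trace_bit_add frobenius_add)

lemma trace_poly_zero [simp]: "trace_poly 0 y = 0" "trace_poly x 0 = 0"
  by (simp_all add: poly_eq_iff coeff_trace_poly power_0_left)

lemma trace_poly_scale:
  "trace_poly (of_bit c * x) y = smult c (trace_poly x y)"
  "trace_poly x (of_bit c * y) = smult c (trace_poly x y)"
  by (cases c; simp)+

text \<open>Tr(x^2 y^(2^(i+1))) = Tr(x y^(2^i)), so squaring \<open>x\<close> shifts the
  coefficients cyclically, which is multiplication by X.\<close>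

lemma trace_poly_square_left: "[trace_poly (x ^ 2) y = pCons 0 (trace_poly x y)] (mod modulus)"
proof -
  obtain m where m: "n = Suc m"
    using n_pos gr0_conv_Suc by blast
  define t where "t = (\<lambda>i. trace_bit (x * y ^ (2 ^ i)))"
  have t: "trace_bit (x ^ 2 * y ^ (2 ^ Suc i)) = t i" for i
    unfolding t_def using trace_square[of "x * y ^ (2 ^ i)"]
    by (intro trace_bit_eqI) (simp add: power_mult_distrib mult.commute flip: power_mult)
  have t0: "trace_bit (x ^ 2 * y ^ (2 ^ 0)) = t m"
    using t[of m] by (simp only: m[symmetric] frobenius_n power_0 power_one_right)
  \<comment> \<open>Only the wrapped coefficient \<open>t m\<close> differs: it stands at X^n on one
    side and at 1 on the other.\<close>
  have "pCons 0 (trace_poly x y) - trace_poly (x ^ 2) y = smult (t m) modulus"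
  proof (rule poly_eqI)
    fix i
    show "coeff (pCons 0 (trace_poly x y) - trace_poly (x ^ 2) y) i = coeff (smult (t m) modulus) i"
    proof (cases i)
      case 0
      then show ?thesis
        using t0 n_pos by (simp add: coeff_trace_poly coeff_monom)
    next
      case (Suc j)
      have "trace_bit (x * y ^ (2 ^ j)) = t j"
        by (simp add: t_def)
      then have lhs: "coeff (pCons 0 (trace_poly x y) - trace_poly (x ^ 2) y) (Suc j)
          = (if j < n then t j else 0) - (if Suc j < n then t j else 0)"
        by (simp only: coeff_diff coeff_pCons_Suc coeff_trace_poly t)
      have rhs: "coeff (smult (t m) modulus) (Suc j) = (if Suc j = n then t m else 0)"
        by (simp add: coeff_monom)
      have "t j = t m" if "Suc j = n"
        using that m by simp
      then show ?thesis
        unfolding Suc lhs rhs by auto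
    qed
  qed
  then show ?thesis
    by (subst cong_sym_eq) (simp add: cong_iff_dvd_diff dvd_smult)
qed

text \<open>Squaring both arguments changes nothing, so squaring \<open>y\<close> acts as the
  inverse of X, which is X^(n-1).\<close>

lemma trace_poly_square_right:
  "[trace_poly x (y ^ 2) = monom 1 (n - 1) * trace_poly x y] (mod modulus)"
proof -
  have "trace_bit (x ^ 2 * (y ^ 2) ^ (2 ^ i)) = trace_bit (x * y ^ (2 ^ i))" for i
    using trace_square[of "x * y ^ (2 ^ i)"]
    by (intro trace_bit_eqI) (simp add: power_mult_distrib mult.commute flip: power_mult)
  then have "trace_poly (x ^ 2) (y ^ 2) = trace_poly x y"
    by (intro poly_eqI) (simp only: coeff_trace_poly)
  then have "[trace_poly x y = pCons 0 (trace_poly x (y ^ 2))] (mod modulus)"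
    using trace_poly_square_left[of x "y ^ 2"] by simp
  then have "[monom 1 (n - 1) * trace_poly x y
      = monom 1 (n - 1) * pCons 0 (trace_poly x (y ^ 2))] (mod modulus)"
    by (rule cong_scalar_left)
  also have "monom 1 (n - 1) * pCons 0 (trace_poly x (y ^ 2)) = monom 1 n * trace_poly x (y ^ 2)"
    using monom_Suc[of "1::bit" "n - 1"] n_pos by simp
  also have "[monom 1 n * trace_poly x (y ^ 2) = 1 * trace_poly x (y ^ 2)] (mod modulus)"
    by (rule cong_scalar_right) (simp add: cong_iff_dvd_diff)
  finally have "[monom 1 (n - 1) * trace_poly x y = trace_poly x (y ^ 2)] (mod modulus)"
    unfolding mult_1 .
  then show ?thesis
    by (rule cong_sym)
qed

text \<open>Modulo \<open>X^n - 1\<close>, this is the substitution of \<open>X^(-1)\<close> for \<open>X\<close>.\<close>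

definition reflect :: "bit poly \<Rightarrow> bit poly" where
  "reflect p = pcompose p (monom 1 (n - 1))"

lemma trace_poly_frob_act_left:
  "[trace_poly (frob_act p x) y = p * trace_poly x y] (mod modulus)"
proof (induction p arbitrary: x)
  case (pCons c p)
  have "[trace_poly (frob_act p (x ^ 2)) y = p * pCons 0 (trace_poly x y)] (mod modulus)"
    using pCons.IH[of "x ^ 2"] cong_scalar_left[OF trace_poly_square_left] cong_trans by blast
  from cong_add[OF cong_refl this, of "smult c (trace_poly x y)"] show ?case
    by (simp only: frob_act_pCons trace_poly_add_left trace_poly_scale mult_pCons_left
        mult_pCons_right smult_0_left add_0)
qed simp

lemma trace_poly_frob_act_right:
  "[trace_poly x (frob_act p y) = reflect p * trace_poly x y] (mod modulus)"
proof (induction p arbitrary: y)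
  case (pCons c p)
  have "[trace_poly x (frob_act p (y ^ 2)) = reflect p * (monom 1 (n - 1) * trace_poly x y)] (mod modulus)"
    using pCons.IH[of "y ^ 2"] cong_scalar_left[OF trace_poly_square_right] cong_trans by blast
  moreover have "reflect (pCons c p) * trace_poly x y
      = smult c (trace_poly x y) + reflect p * (monom 1 (n - 1) * trace_poly x y)"
    by (simp add: reflect_def pcompose_pCons algebra_simps)
  ultimately show ?case
    by (simp only: frob_act_pCons trace_poly_add_right trace_poly_scale cong_add[OF cong_refl])
qed (simp add: reflect_def)

section \<open>Reflection and symmetric polynomials\<close>

text \<open>Substituting X^k turns X^n - 1 into its multiple X^(nk) - 1, so the substitution is well
  defined on the quotient ring.\<close>

lemma cong_pcompose_monom:
  assumes "[p = q] (mod modulus)"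
  shows "[pcompose p (monom 1 k) = pcompose q (monom 1 k)] (mod modulus)"
proof -
  obtain r where "p - q = modulus * r"
    using assms by (auto simp: cong_iff_dvd_diff elim: dvdE)
  then have "pcompose p (monom 1 k) - pcompose q (monom 1 k) = pcompose (modulus * r) (monom 1 k)"
    by (simp only: flip: pcompose_diff)
  also have "\<dots> = (monom 1 (n * k) - 1) * pcompose r (monom 1 k)"
    by (simp only: pcompose_mult pcompose_diff monom_pcompose_monom pcompose_1 mult.commute[of k n])
  finally have "pcompose p (monom 1 k) - pcompose q (monom 1 k)
      = (monom 1 (n * k) - 1) * pcompose r (monom 1 k)" .
  then show ?thesis
    by (simp add: cong_iff_dvd_diff dvd_mult dvd_mult2 monom_diff_one_dvd)
qed

lemma reflect_eq_sum:
  assumes "degree p < n"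
  shows "reflect p = (\<Sum>i<n. monom (coeff p i) ((n - 1) * i))"
proof -
  have "reflect p = pcompose (\<Sum>i<n. monom (coeff p i) i) (monom 1 (n - 1))"
    using vector_poly_coeff[OF assms] by (simp add: vector_poly_def reflect_def)
  then show ?thesis
    by (simp add: pcompose_sum monom_pcompose_monom)
qed

lemma monom_mult_cong: "[monom c (j + n * k) = monom c j] (mod modulus)"
proof -
  have "monom c (j + n * k) - monom c j = monom c j * (monom 1 (n * k) - 1)"
    by (simp add: algebra_simps mult_monom)
  then show ?thesis
    by (simp add: cong_iff_dvd_diff dvd_mult dvd_mult2 monom_diff_one_dvd)
qed

text \<open>Reflection exchanges the exponents i and n - i for 0 < i < n and fixes the constant
  term.\<close>

lemma reflect_cong_self:
  assumes "degree p < n" "symmetric_poly n p"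
  shows "[reflect p = p] (mod modulus)"
proof -
  obtain m where m: "n = Suc m"
    using n_pos gr0_conv_Suc by blast
  have lt: "{..<n} = {..<Suc m}" and pred: "n - 1 = m"
    by (simp_all add: m)
  have "[monom (coeff p (Suc i)) (m * Suc i) = monom (coeff p (m - i)) (m - i)] (mod modulus)"
    if "i < m" for i
  proof -
    obtain k where "m = i + k"
      using \<open>i < m\<close> less_imp_add_positive by blast
    \<comment> \<open>With m = n - 1 this reduces the exponent of the reflected monomial modulo
      \<open>n\<close>.\<close>
    then have "m * Suc i = (m - i) + n * i"
      by (simp add: m)
    moreover have "Suc i \<in> {1..n - 1}"
      using \<open>i < m\<close> by (simp add: m)
    then have "coeff p (Suc i) = coeff p (n - Suc i)"
      using assms(2) unfolding symmetric_poly_def by blast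
    then have "coeff p (Suc i) = coeff p (m - i)"
      by (simp add: m)
    ultimately show ?thesis
      using monom_mult_cong[of "coeff p (m - i)" "m - i" i] by (simp only:)
  qed
  then have "[(\<Sum>i<m. monom (coeff p (Suc i)) (m * Suc i)) = (\<Sum>i<m. monom (coeff p (m - i)) (m - i))] (mod modulus)"
    by (intro cong_sum) auto
  also have "(\<Sum>i<m. monom (coeff p (m - i)) (m - i)) = (\<Sum>i<m. monom (coeff p (Suc i)) (Suc i))"
    by (rule sum.reindex_bij_witness[of _ "\<lambda>i. m - Suc i" "\<lambda>i. m - Suc i"]) (auto simp: Suc_diff_Suc)
  finally have "[monom (coeff p 0) 0 + (\<Sum>i<m. monom (coeff p (Suc i)) (m * Suc i))
      = monom (coeff p 0) 0 + (\<Sum>i<m. monom (coeff p (Suc i)) (Suc i))] (mod modulus)"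
    by (rule cong_add[OF cong_refl])
  moreover have "reflect p = monom (coeff p 0) 0 + (\<Sum>i<m. monom (coeff p (Suc i)) (m * Suc i))"
    unfolding reflect_eq_sum[OF assms(1)] lt pred by (subst sum.lessThan_Suc_shift) simp
  moreover have "vector_poly n (coeff p) = monom (coeff p 0) 0 + (\<Sum>i<m. monom (coeff p (Suc i)) (Suc i))"
    unfolding vector_poly_def lt by (rule sum.lessThan_Suc_shift)
  ultimately show ?thesis
    by (simp only: vector_poly_coeff[OF assms(1)])
qed

text \<open>Raising \<alpha> \<alpha>^(2^i) to the power 2^(n-i) preserves the trace and gives
  \<alpha>^(2^(n-i)) \<alpha>.\<close>

lemma symmetric_trace_poly: "symmetric_poly n (trace_poly \<alpha> \<alpha>)"
  unfolding symmetric_poly_def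
proof
  fix i assume i: "i \<in> {1..n - 1}"
  then have ni: "i + (n - i) = n"
    by auto
  have "(\<alpha> * \<alpha> ^ (2 ^ i)) ^ (2 ^ (n - i)) = \<alpha> ^ (2 ^ (n - i)) * \<alpha> ^ (2 ^ i * 2 ^ (n - i))"
    by (simp add: power_mult_distrib power_mult)
  also have "(2::nat) ^ i * 2 ^ (n - i) = 2 ^ n"
    using ni by (simp flip: power_add)
  finally have "trace_map n (\<alpha> * \<alpha> ^ (2 ^ i)) = trace_map n (\<alpha> * \<alpha> ^ (2 ^ (n - i)))"
    using trace_frobenius[of "\<alpha> * \<alpha> ^ (2 ^ i)" "n - i"] by (simp add: mult.commute)
  then show "coeff (trace_poly \<alpha> \<alpha>) i = coeff (trace_poly \<alpha> \<alpha>) (n - i)"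
    using i by (auto simp: coeff_trace_poly intro: trace_bit_eqI)
qed

section \<open>Nondegeneracy and the unit criterion\<close>

text \<open>Sesquilinearity and surjectivity of p -> p(\<alpha>) extend F(x, \<alpha>) = 0 to F(x,
  y) = 0 for all y; at y = z / x the constant coefficient is the trace of \<open>z\<close>.\<close>

lemma trace_poly_nondegenerate:
  assumes "free_element \<alpha>" "trace_poly x \<alpha> = 0"
  shows "x = 0"
proof (rule ccontr)
  assume "x \<noteq> 0"
  obtain z where z: "trace_map n z \<noteq> (0::'a)"
    using exists_trace_nonzero by blast
  obtain p where p: "z / x = frob_act p \<alpha>"
    using assms(1) free_element_iff_surj by blast
  have "[trace_poly x (frob_act p \<alpha>) = 0] (mod modulus)"
    using trace_poly_frob_act_right[of x p \<alpha>] assms(2) by simp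
  then have "trace_poly x (frob_act p \<alpha>) = 0"
    by (rule eq_if_cong) (simp_all add: degree_trace_poly n_pos)
  then have "trace_poly x (z / x) = 0"
    by (simp only: p)
  then have "trace_bit z = 0"
    using coeff_trace_poly[of x "z / x" 0] n_pos \<open>x \<noteq> 0\<close> by simp
  then show False
    using z by (simp add: trace_bit_def split: if_splits)
qed

text \<open>If \<alpha> is free, the cofactor \<open>p\<close> of the gcd satisfies F(p \<alpha>,
  \<alpha>) = 0, so p \<alpha> = 0 and \<open>p\<close> has full degree. Conversely, p \<alpha> = 0
  gives p F(\<alpha>, \<alpha>) = 0, where the unit cancels.\<close>

lemma free_element_iff_coprime: "free_element \<alpha> \<longleftrightarrow> coprime (trace_poly \<alpha> \<alpha>) modulus"
proof
  assume free: "free_element \<alpha>"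
  define d where "d = gcd (trace_poly \<alpha> \<alpha>) modulus"
  have "d dvd modulus" "d dvd trace_poly \<alpha> \<alpha>"
    by (simp_all add: d_def)
  then obtain p q where p: "modulus = d * p" and q: "trace_poly \<alpha> \<alpha> = d * q"
    by (elim dvdE)
  have nz: "d \<noteq> 0" "p \<noteq> 0"
    using modulus_nonzero unfolding p by auto
  have "p * trace_poly \<alpha> \<alpha> = modulus * q"
    by (simp add: p q)
  then have "[trace_poly (frob_act p \<alpha>) \<alpha> = 0] (mod modulus)"
    using trace_poly_frob_act_left[of p \<alpha> \<alpha>] cong_mult_self_left cong_trans by metis
  then have "trace_poly (frob_act p \<alpha>) \<alpha> = 0"
    by (rule eq_if_cong) (simp_all add: degree_trace_poly n_pos)
  then have "frob_act p \<alpha> = 0"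
    using trace_poly_nondegenerate[OF free] by blast
  then have "\<not> degree p < n"
    using free nz by (auto simp: free_element_def)
  moreover have "degree d + degree p = n"
    using degree_mult_eq[OF nz] p degree_modulus by metis
  ultimately have "is_unit d"
    using nz is_unit_iff_degree[OF nz(1)] by simp
  then show "coprime (trace_poly \<alpha> \<alpha>) modulus"
    by (simp add: d_def coprime_iff_gcd_eq_1)
next
  assume cop: "coprime (trace_poly \<alpha> \<alpha>) modulus"
  show "free_element \<alpha>"
    unfolding free_element_def
  proof (intro allI impI)
    fix p assume p: "degree p < n" "frob_act p \<alpha> = 0"
    have "[p * trace_poly \<alpha> \<alpha> = 0] (mod modulus)"
      using trace_poly_frob_act_left[of p \<alpha> \<alpha>, THEN cong_sym] p by simp
    then have "modulus dvd p * trace_poly \<alpha> \<alpha>"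
      by (simp only: cong_0_iff)
    then have "modulus dvd p"
      using cop by (simp add: coprime_commute coprime_dvd_mult_left_iff)
    then show "p = 0"
      using p eq_zero_if_modulus_dvd by blast
  qed
qed

section \<open>Solving F(\<alpha>, \<alpha>) = p for symmetric p\<close>

lemma exists_cong_divisor:
  assumes "coprime q modulus"
  obtains u where "[u * q = p] (mod modulus)"
proof -
  obtain s t where st: "s * q + t * modulus = 1"
    using assms bezout_coefficients[of q modulus] by (metis coprime_iff_gcd_eq_1 prod.collapse)
  then have "1 - s * q = t * modulus"
    by (metis add_diff_cancel_left')
  then have "[1 = s * q] (mod modulus)"
    unfolding cong_iff_dvd_diff by (metis dvd_triv_right)
  then have "[p * 1 = p * (s * q)] (mod modulus)"
    by (rule cong_scalar_left)
  then have "[p * s * q = p] (mod modulus)"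
    unfolding mult_1_right mult.assoc by (rule cong_sym)
  then show ?thesis
    by (rule that)
qed

text \<open>Squaring \<open>u(X^((n+1)/2))\<close> gives \<open>u(X^(n+1))\<close>, which is congruent to \<open>u\<close>.\<close>

lemma norm_form_surj:
  assumes "[reflect u = u] (mod modulus)"
  obtains h where "[h * reflect h = u] (mod modulus)"
proof -
  define k where "k = (n + 1) div 2"
  define h where "h = pcompose u (monom 1 k)"
  \<comment> \<open>Substitutions of monomials commute, so \<open>h\<close> inherits the symmetry of
    \<open>u\<close> and its norm is h^2.\<close>
  have "reflect h = pcompose (reflect u) (monom 1 k)"
    by (simp add: h_def reflect_def monom_pcompose_monom mult.commute flip: pcompose_assoc)
  then have "[reflect h = h] (mod modulus)"
    using cong_pcompose_monom[OF assms] by (simp add: h_def)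
  then have "[h * reflect h = h ^ 2] (mod modulus)"
    by (simp add: power2_eq_square cong_scalar_left)
  also have "h ^ 2 = pcompose u (monom 1 (n + 1))"
    using odd_n by (simp add: bit_poly_square h_def monom_pcompose_monom k_def flip: pcompose_assoc)
  also have "[pcompose u (monom 1 (n + 1)) = u] (mod modulus)"
  proof (induction u)
    case (pCons c u)
    have "[monom 1 (n + 1) = monom (1::bit) 1] (mod modulus)"
      using monom_mult_cong[of 1 1 1] by (simp add: add.commute)
    then have "[monom 1 (n + 1) * pcompose u (monom 1 (n + 1)) = monom 1 1 * u] (mod modulus)"
      using pCons.IH by (rule cong_mult)
    also have "monom 1 1 * u = pCons 0 u"
      by (simp add: monom_altdef)
    finally have "[[:c:] + monom 1 (n + 1) * pcompose u (monom 1 (n + 1)) = [:c:] + pCons 0 u] (mod modulus)"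
      by (rule cong_add[OF cong_refl])
    then show ?case
      by (simp add: pcompose_pCons)
  qed simp
  finally show ?thesis
    by (rule that)
qed

lemma exists_trace_poly_eq:
  assumes "degree p < n" "symmetric_poly n p"
  obtains \<alpha> where "trace_poly \<alpha> \<alpha> = p"
proof -
  obtain \<beta> where \<beta>: "free_element \<beta>"
    using exists_free_element by blast
  define q where "q = trace_poly \<beta> \<beta>"
  have cop: "coprime q modulus"
    using \<beta> by (simp add: q_def free_element_iff_coprime)
  obtain u where u: "[u * q = p] (mod modulus)"
    using exists_cong_divisor[OF cop] by blast
  have q: "[reflect q = q] (mod modulus)"
    by (simp add: q_def reflect_cong_self degree_trace_poly symmetric_trace_poly)
  \<comment> \<open>Reflecting u q = p, where \<open>q\<close> and \<open>p\<close> are symmetric,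
    and cancelling the unit \<open>q\<close> shows that \<open>u\<close> is symmetric.\<close>
  have "[reflect u * q = reflect u * reflect q] (mod modulus)"
    using q[THEN cong_sym] by (rule cong_scalar_left)
  also have "reflect u * reflect q = reflect (u * q)"
    by (simp add: reflect_def pcompose_mult)
  also have "[reflect (u * q) = reflect p] (mod modulus)"
    using cong_pcompose_monom[OF u] by (simp add: reflect_def)
  also have "[reflect p = p] (mod modulus)"
    using assms by (rule reflect_cong_self)
  also have "[p = u * q] (mod modulus)"
    using u by (rule cong_sym)
  finally have "[reflect u = u] (mod modulus)"
    using cop by (simp add: cong_mult_rcancel)
  then obtain h where h: "[h * reflect h = u] (mod modulus)"
    using norm_form_surj by blast
  define \<alpha> where "\<alpha> = frob_act h \<beta>"
  have "[trace_poly \<alpha> \<alpha> = h * trace_poly \<beta> \<alpha>] (mod modulus)"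
    unfolding \<alpha>_def by (rule trace_poly_frob_act_left)
  also have "[h * trace_poly \<beta> \<alpha> = h * (reflect h * q)] (mod modulus)"
    unfolding \<alpha>_def q_def by (intro cong_scalar_left trace_poly_frob_act_right)
  also have "h * (reflect h * q) = h * reflect h * q"
    by (simp add: mult.assoc)
  also have "[h * reflect h * q = u * q] (mod modulus)"
    using h by (rule cong_scalar_right)
  also note u
  finally have "trace_poly \<alpha> \<alpha> = p"
    using assms(1) degree_trace_poly eq_if_cong by blast
  then show ?thesis
    by (rule that)
qed

section \<open>Corresponding vectors and the equivalence\<close>

lemma corresponding_vector_iff:
  "(\<forall>i<n. corresponding_vector n \<alpha> i = of_bit (a i)) \<longleftrightarrow> trace_poly \<alpha> \<alpha> = vector_poly n a"
proof -
  have "corresponding_vector n \<alpha> i = of_bit (coeff (trace_poly \<alpha> \<alpha>) i)" if "i < n" for i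
    by (simp only: corresponding_vector_def of_bit_trace_bit coeff_trace_poly that if_True)
  moreover have "(of_bit c :: 'a) = of_bit d \<longleftrightarrow> c = d" for c d
    by (cases c; cases d) simp_all
  ultimately have "(\<forall>i<n. corresponding_vector n \<alpha> i = of_bit (a i))
      \<longleftrightarrow> (\<forall>i<n. coeff (trace_poly \<alpha> \<alpha>) i = a i)"
    by metis
  also have "\<dots> \<longleftrightarrow> trace_poly \<alpha> \<alpha> = vector_poly n a"
    by (auto simp: poly_eq_iff coeff_vector_poly coeff_trace_poly)
  finally show ?thesis .
qed

text \<open>Both sides become conditions on F(\<alpha>, \<alpha>); once its value is prescribed,
  coprimality of that value is what makes \<alpha> normal.\<close>

theorem normal_element_with_vector_iff:
  "(\<exists>\<alpha>::'a. normal_element n \<alpha> \<and> (\<forall>i<n. corresponding_vector n \<alpha> i = of_bit (a i)))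
     \<longleftrightarrow> symmetric_poly n (vector_poly n a) \<and> gcd (vector_poly n a) (monom 1 n - 1) = 1"
  unfolding corresponding_vector_iff normal_element_iff_free free_element_iff_coprime
    coprime_iff_gcd_eq_1[symmetric]
proof (intro iffI; elim exE conjE)
  fix \<alpha> assume "coprime (trace_poly \<alpha> \<alpha>) modulus" "trace_poly \<alpha> \<alpha> = vector_poly n a"
  then show "symmetric_poly n (vector_poly n a) \<and> coprime (vector_poly n a) modulus"
    using symmetric_trace_poly[of \<alpha>] by simp
next
  assume *: "symmetric_poly n (vector_poly n a)" "coprime (vector_poly n a) modulus"
  obtain \<alpha> where "trace_poly \<alpha> \<alpha> = vector_poly n a"
    using exists_trace_poly_eq[OF degree_vector_poly_less[OF n_pos] *(1)] by metis
  then show "\<exists>\<alpha>. coprime (trace_poly \<alpha> \<alpha>) modulus \<and> trace_poly \<alpha> \<alpha> = vector_poly n a"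
    using *(2) by (intro exI[of _ \<alpha>]) simp
qed

end

theorem theorem4p2:
  fixes n :: nat and a :: "nat \<Rightarrow> bit"
  assumes "odd n"
    and "CARD('a::{field,finite}) = 2 ^ n"
  shows "(\<exists>\<alpha>::'a. normal_element n \<alpha> \<and>
             (\<forall>i<n. corresponding_vector n \<alpha> i = of_bit (a i)))
     \<longleftrightarrow> symmetric_poly n (vector_poly n a) \<and>
         gcd (vector_poly n a) (monom 1 n - 1) = 1"
proof -
  interpret binary_field n "TYPE('a)"
    by standard (fact assms)+
  show ?thesis
    by (rule normal_element_with_vector_iff)
qed

end
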